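(* Consider the time-varying semidefinite program (TV-SDP) $$\sup_{x\in \mathbf{L}^n}\ \int_0^1\langle c(t),x(t)\rangle\,dt\quad\text{subject to}\quad Fx(t)\succeq 0\ \text{ for almost every } t\in[0,1],$$ with polynomial data $c, A_0,\dots,A_n,D_1,\dots,D_n$. Suppose that the TV-SDP is feasible and that there exists $\gamma>0$ such that every feasible solution $x$ satisfies $\|x(t)\|_\infty\le\gamma$ for almost every $t\in[0,1]$. Then there exists a feasible function $x^{\mathrm{opt}}\in\mathbf{L}^n$ that attains the optimal value, i.e. $\int_0^1\langle c(t),x^{\mathrm{opt}}(t)\rangle\,dt$ equals the supremum.
   Context: $\mathbf{L}^n$ is the set of measurable functions $x:[0,1]\to\mathbb{R}^n$ with $\sup_{t\in[0,1],\,i}|x_i(t)|<\infty$. The data are: $c$, a vector of $n$ univariate real polynomials; $A_0,\dots,A_n$, symmetric $m\times m$ matrices whose entries are real polynomials in $t$; $D_1,\dots,D_n$, symmetric $m\times m$ matrices whose entries are real polynomials in $(t,s)$. For $x\in\mathbf{L}^n$, $$Fx(t)=A_0(t)+\sum_{i=1}^n x_i(t)A_i(t)+\sum_{i=1}^n\int_0^t x_i(s)D_i(t,s)\,ds.$$ $M\succeq0$ means that the symmetric matrix $M$ is positive semidefinite. "Almost every" refers to Lebesgue measure. A feasible solution is an $x\in\mathbf{L}^n$ with $Fx(t)\succeq0$ for almost every $t\in[0,1]$. $\langle\cdot,\cdot\rangle$ is the standard inner product of $\mathbb{R}^n$ and $\|v\|_\infty=\max_i|v_i|$. *)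

theory Defs
  imports "HOL-Analysis.Analysis"
begin

(* A function [0,1] -> R^n is represented by a total function on the reals; all notions below
   only use its values on {0..1}. Measurability is Lebesgue measurability, and boundedness is
   required at every point, not merely almost everywhere. *)
definition Ln :: "(real \<Rightarrow> real ^ 'n) set" where
  "Ln = {x. x \<in> borel_measurable (lebesgue_on {0..1}) \<and>
            bdd_above {\<bar>x t $ i\<bar> | t i. t \<in> {0..1}}}"

definition sym_mat :: "real ^ 'm ^ 'm \<Rightarrow> bool" where
  "sym_mat M \<longleftrightarrow> transpose M = M"

definition psd :: "real ^ 'm ^ 'm \<Rightarrow> bool" where
  "psd M \<longleftrightarrow> sym_mat M \<and> (\<forall>v. 0 \<le> v \<bullet> (M *v v))"

definition poly_vec :: "('a::real_normed_vector \<Rightarrow> real ^ 'n) \<Rightarrow> bool" where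
  "poly_vec c \<longleftrightarrow> (\<forall>i. real_polynomial_function (\<lambda>t. c t $ i))"

definition sym_poly_mat :: "('a::real_normed_vector \<Rightarrow> real ^ 'm ^ 'm) \<Rightarrow> bool" where
  "sym_poly_mat M \<longleftrightarrow>
     (\<forall>t. sym_mat (M t)) \<and> (\<forall>j k. real_polynomial_function (\<lambda>t. M t $ j $ k))"

definition tvsdp_F ::
  "(real \<Rightarrow> real ^ 'm ^ 'm) \<Rightarrow> ('n \<Rightarrow> real \<Rightarrow> real ^ 'm ^ 'm) \<Rightarrow>
   ('n \<Rightarrow> real \<times> real \<Rightarrow> real ^ 'm ^ 'm) \<Rightarrow> (real \<Rightarrow> real ^ 'n) \<Rightarrow> real \<Rightarrow> real ^ 'm ^ 'm" where
  "tvsdp_F A0 A D x t =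
     A0 t + (\<Sum>i\<in>UNIV. x t $ i *\<^sub>R A i t)
          + (\<Sum>i\<in>UNIV. LINT s|lebesgue_on {0..t}. x s $ i *\<^sub>R D i (t, s))"

definition tvsdp_feasible ::
  "(real \<Rightarrow> real ^ 'm ^ 'm) \<Rightarrow> ('n \<Rightarrow> real \<Rightarrow> real ^ 'm ^ 'm) \<Rightarrow>
   ('n \<Rightarrow> real \<times> real \<Rightarrow> real ^ 'm ^ 'm) \<Rightarrow> (real \<Rightarrow> real ^ 'n) set" where
  "tvsdp_feasible A0 A D = {x \<in> Ln. AE t in lebesgue_on {0..1}. psd (tvsdp_F A0 A D x t)}"

definition tvsdp_objective :: "(real \<Rightarrow> real ^ 'n) \<Rightarrow> (real \<Rightarrow> real ^ 'n) \<Rightarrow> real" where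
  "tvsdp_objective c x = (LINT t|lebesgue_on {0..1}. c t \<bullet> x t)"

(* The supremum is taken in the extended reals, since Sup on the type real is unspecified for
   unbounded sets. *)
definition tvsdp_value ::
  "(real \<Rightarrow> real ^ 'n) \<Rightarrow> (real \<Rightarrow> real ^ 'm ^ 'm) \<Rightarrow> ('n \<Rightarrow> real \<Rightarrow> real ^ 'm ^ 'm) \<Rightarrow>
   ('n \<Rightarrow> real \<times> real \<Rightarrow> real ^ 'm ^ 'm) \<Rightarrow> ereal" where
  "tvsdp_value c A0 A D = (SUP x\<in>tvsdp_feasible A0 A D. ereal (tvsdp_objective c x))"

end

theory Submission
  imports Defs
begin

text \<open>
  The feasible set is convex, closed and bounded in \<open>L\<^sup>2\<close>, and the objective is linear and
  continuous, so weak compactness yields an optimal solution.  The proof replaces weak limits by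
  strong ones: by convexity, a maximizing sequence that converges strongly can be chosen directly.

  Let \<open>a k\<close> be objective values of feasible solutions that increase to the optimal value, and let
  \<open>S k\<close> be the set of feasible solutions with objective at least \<open>a k\<close>.  These sets are nonempty,
  decreasing and closed under midpoints.  The infima of the squared \<open>L\<^sup>2\<close> norm over \<open>S k\<close> increase
  with \<open>k\<close>, and they stay bounded because of the bound \<open>\<gamma>\<close> on all feasible solutions.  Almost
  minimizers of the norm over \<open>S k\<close>, taken far enough in the sequence, are therefore Cauchy in
  \<open>L\<^sup>2\<close> by the parallelogram law (\<open>exists_L2_Cauchy_selection\<close>), with increments that decay so fast
  that the sequence converges almost everywhere (\<open>AE_convergent_of_L2_increments\<close>).

  All members of the sequence obey the same almost everywhere bound, so dominated convergence
  applies both to the Volterra term of \<open>F\<close> and to the objective.  Since the semidefinite cone is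
  closed, the limit is feasible (\<open>tvsdp_feasible_limit\<close>), and its objective is at least every
  \<open>a k\<close> (\<open>tvsdp_objective_tendsto\<close>), hence equal to the optimal value.
\<close>

section \<open>Strong convergence of a minimizing sequence\<close>

text \<open>
  The parallelogram law turns almost minimality of the norm into closeness: if \<open>x\<close>, \<open>y\<close> and
  their midpoint lie in a set on which the squared norm is at least \<open>l - e\<close>, while \<open>x\<close> and \<open>y\<close>
  have squared norm at most \<open>l + e\<close>, then their squared distance is at most \<open>8 * e\<close>.  The value
  \<open>l\<close> to use is the limit of the increasing sequence of infima over the sets \<open>S k\<close>.
\<close>

lemma exists_L2_Cauchy_selection:
  fixes S :: "nat \<Rightarrow> ('a \<Rightarrow> 'b::real_inner) set"
  assumes nonempty: "\<And>k. S k \<noteq> {}"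
    and decseq: "decseq S"
    and midpoint: "\<And>k x y. x \<in> S k \<Longrightarrow> y \<in> S k \<Longrightarrow> (\<lambda>t. (1/2) *\<^sub>R (x t + y t)) \<in> S k"
    and integrable: "\<And>x y. x \<in> S 0 \<Longrightarrow> y \<in> S 0 \<Longrightarrow> integrable M (\<lambda>t. x t \<bullet> y t)"
    and bounded: "\<And>x. x \<in> S 0 \<Longrightarrow> (LINT t|M. x t \<bullet> x t) \<le> B"
  shows "\<exists>y. \<forall>k. y k \<in> S k \<and> (LINT t|M. (norm (y (Suc k) t - y k t))\<^sup>2) \<le> (1/4)^k"
proof -
  define N :: "('a \<Rightarrow> 'b) \<Rightarrow> real" where "N x = (LINT t|M. x t \<bullet> x t)" for x
  define d where "d k = Inf (N ` S k)" for k
  have sub: "S j \<subseteq> S k" if "k \<le> j" for k j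
    using decseq that by (auto simp: decseq_def)
  have bdd: "bdd_below (N ` S k)" for k
    by (rule bdd_belowI[of _ 0]) (auto simp: N_def)
  have d_le: "d k \<le> N x" if "x \<in> S k" for k x
    unfolding d_def using bdd that by (rule cINF_lower)
  have "incseq d"
    unfolding incseq_def d_def using sub nonempty bdd by (intro allI impI cInf_superset_mono) auto
  moreover have "d k \<le> B" for k
  proof -
    obtain x where "x \<in> S k" using nonempty by blast
    then show ?thesis
      using d_le[of x k] bounded[of x] sub[of 0 k] by (auto simp: N_def)
  qed
  ultimately obtain l where l: "d \<longlonglongrightarrow> l" and d_le_l: "\<And>k. d k \<le> l"
    using incseq_convergent[of d B] by blast
  define e :: "nat \<Rightarrow> real" where "e k = (1/4)^k / 8" for k
  have e_pos: "e k > 0" for k by (simp add: e_def)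
  have e_mono: "e (Suc k) \<le> e k" for k by (simp add: e_def)
  have "\<exists>r\<ge>k. l - e k \<le> d r" for k
  proof -
    have "eventually (\<lambda>r. l - e k < d r \<and> r \<ge> k) sequentially"
      using order_tendstoD(1)[OF l, of "l - e k"] e_pos[of k] eventually_ge_at_top[of k]
      by (auto intro: eventually_conj)
    then show ?thesis
      unfolding eventually_sequentially by (meson less_imp_le order_refl)
  qed
  then obtain r where r: "\<And>k. k \<le> r k" "\<And>k. l - e k \<le> d (r k)"
    by metis
  \<comment> \<open>Taking the maximum makes the chosen indices increase, so that \<open>y (Suc k)\<close> also lies in the
    set from which \<open>y k\<close> is taken.\<close>
  define q where "q k = Max (r ` {..k})" for k
  have q_mono: "q k \<le> q (Suc k)" for k
    unfolding q_def by (rule Max_mono) auto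
  have r_le_q: "r k \<le> q k" for k
    unfolding q_def by (rule Max_ge) auto
  have q_lower: "l - e k \<le> d (q k)" for k
    using r(2)[of k] \<open>incseq d\<close> r_le_q[of k] by (force simp: incseq_def intro: order_trans)
  have "\<exists>x\<in>S (q k). N x < l + e k" for k
  proof -
    have "Inf (N ` S (q k)) < l + e k"
      using d_le_l[of "q k"] e_pos[of k] by (simp add: d_def)
    then show ?thesis
      using cInf_lessD[of "N ` S (q k)"] nonempty by blast
  qed
  then obtain y where y: "\<And>k. y k \<in> S (q k)" and N_y: "\<And>k. N (y k) < l + e k"
    by metis
  have "(LINT t|M. (norm (y (Suc k) t - y k t))\<^sup>2) \<le> (1/4)^k" for k
  proof -
    let ?x = "y k" and ?z = "y (Suc k)"
    define m where "m = (\<lambda>t. (1/2) *\<^sub>R (?x t + ?z t))"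
    have z: "?z \<in> S (q k)" using y sub q_mono by blast
    have m: "m \<in> S (q k)" unfolding m_def using midpoint y z by blast
    have [simp]: "integrable M (\<lambda>t. ?x t \<bullet> ?x t)" "integrable M (\<lambda>t. ?z t \<bullet> ?z t)"
      "integrable M (\<lambda>t. m t \<bullet> m t)"
      using integrable y z m sub[of 0 "q k"] by blast+
    have "(LINT t|M. (norm (?z t - ?x t))\<^sup>2)
        = (LINT t|M. 2 * (?x t \<bullet> ?x t) + 2 * (?z t \<bullet> ?z t) - 4 * (m t \<bullet> m t))"
      by (intro Bochner_Integration.integral_cong refl)
        (simp add: m_def power2_norm_eq_inner inner_simps inner_commute algebra_simps)
    also have "\<dots> = 2 * N ?x + 2 * N ?z - 4 * N m"
      unfolding N_def by simp
    also have "\<dots> \<le> 8 * e k"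
    proof -
      have "l - e k \<le> N m" using q_lower d_le[OF m] by (rule order_trans)
      moreover have "N ?z \<le> l + e k" using N_y[of "Suc k"] e_mono[of k] by simp
      ultimately show ?thesis using N_y[of k] by simp
    qed
    also have "\<dots> = (1/4)^k" by (simp add: e_def)
    finally show ?thesis .
  qed
  moreover have "y k \<in> S k" for k
    using y[of k] sub[of k "q k"] r(1)[of k] r_le_q[of k] by auto
  ultimately show ?thesis by blast
qed

text \<open>
  This is the part of the Riesz--Fischer theorem that is needed below.  On a finite measure space
  the geometric decay of the squared distances makes the distances themselves summable in
  \<open>L\<^sup>1\<close>, so by monotone convergence the increments are absolutely summable almost
  everywhere.
\<close>

lemma (in finite_measure) AE_convergent_of_L2_increments:
  fixes y :: "nat \<Rightarrow> 'a \<Rightarrow> 'b::{banach, second_countable_topology}"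
  assumes [measurable]: "\<And>k. y k \<in> borel_measurable M"
    and integrable: "\<And>k. integrable M (\<lambda>t. (norm (y (Suc k) t - y k t))\<^sup>2)"
    and increments: "\<And>k. (LINT t|M. (norm (y (Suc k) t - y k t))\<^sup>2) \<le> (1/4)^k"
  shows "AE t in M. convergent (\<lambda>k. y k t)"
proof -
  define \<delta> where "\<delta> k t = norm (y (Suc k) t - y k t)" for k t
  define C where "C = measure M (space M) + 1"
  have \<delta>_meas[measurable]: "\<delta> k \<in> borel_measurable M" for k
    unfolding \<delta>_def by measurable
  \<comment> \<open>This weight makes both terms decay like \<open>(1/2)^k\<close> after integration, since the integral of
    the squared increment is at most \<open>(1/4)^k\<close>.\<close>
  have pointwise: "a \<le> (1/2)^k + 2^k * a\<^sup>2" for a :: real and k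
  proof -
    have "0 \<le> (1/2)^k * (1 - 2^k * a)\<^sup>2" by simp
    also have "\<dots> = (1/2)^k + 2^k * a\<^sup>2 - 2 * a"
      by (simp add: power2_eq_square algebra_simps power_divide)
    finally have "2 * a \<le> (1/2)^k + 2^k * a\<^sup>2" by simp
    moreover have "0 \<le> (1/2)^k + 2^k * a\<^sup>2" by simp
    ultimately show ?thesis by linarith
  qed
  have L1: "(\<integral>\<^sup>+t. \<delta> k t \<partial>M) \<le> ennreal (C * (1/2)^k)" for k
  proof -
    have int: "integrable M (\<lambda>t. (1/2)^k + 2^k * (\<delta> k t)\<^sup>2)"
      using integrable[of k] by (simp add: \<delta>_def)
    have "(\<integral>\<^sup>+t. \<delta> k t \<partial>M) \<le> (\<integral>\<^sup>+t. ennreal ((1/2)^k + 2^k * (\<delta> k t)\<^sup>2) \<partial>M)"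
      using pointwise by (intro nn_integral_mono ennreal_leI) 
    also have "\<dots> = ennreal (LINT t|M. (1/2)^k + 2^k * (\<delta> k t)\<^sup>2)"
      using int by (intro nn_integral_eq_integral) auto
    also have "(LINT t|M. (1/2)^k + 2^k * (\<delta> k t)\<^sup>2)
        = measure M (space M) * (1/2)^k + 2^k * (LINT t|M. (\<delta> k t)\<^sup>2)"
      using integrable[of k] by (simp add: \<delta>_def)
    also have "\<dots> \<le> measure M (space M) * (1/2)^k + 2^k * (1/4)^k"
      using increments[of k] by (simp add: \<delta>_def)
    also have "\<dots> = C * (1/2)^k"
      by (simp add: C_def algebra_simps flip: power_mult_distrib)
    finally show ?thesis by (simp add: ennreal_leI)
  qed
  have "(\<integral>\<^sup>+t. (\<Sum>k. ennreal (\<delta> k t)) \<partial>M) = (\<Sum>k. \<integral>\<^sup>+t. \<delta> k t \<partial>M)"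
    by (rule nn_integral_suminf) measurable
  also have "\<dots> \<le> (\<Sum>k. ennreal (C * (1/2)^k))"
    using L1 by (intro suminf_le) auto
  also have "\<dots> < \<infinity>"
    by (subst suminf_ennreal2) (auto simp: C_def intro!: summable_mult summable_geometric)
  finally have "AE t in M. (\<Sum>k. ennreal (\<delta> k t)) \<noteq> \<infinity>"
    by (intro nn_integral_PInf_AE) auto
  then show ?thesis
  proof eventually_elim
    case (elim t)
    then have "summable (\<lambda>k. \<delta> k t)"
      by (intro summable_suminf_not_top) (auto simp: \<delta>_def)
    then have "summable (\<lambda>k. y (Suc k) t - y k t)"
      unfolding \<delta>_def by (rule summable_norm_cancel)
    then have "convergent (\<lambda>n. y n t - y 0 t)"
      by (simp add: summable_iff_convergent sum_lessThan_telescope[of "\<lambda>k. y k t"])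
    then show ?case
      using convergent_add_const_iff[of "- y 0 t" "\<lambda>n. y n t"] by simp
  qed
qed

section \<open>Continuity of the data and closedness of the semidefinite cone\<close>

lemma poly_vec_continuous_on:
  assumes "poly_vec c" shows "continuous_on S c"
proof -
  have "continuous_on S (\<lambda>t. c t $ i)" for i
    using assms unfolding poly_vec_def
    by (intro continuous_at_imp_continuous_on ballI continuous_real_polymonial_function) blast
  then have "continuous_on S (\<lambda>t. \<chi> i. c t $ i)"
    by (intro continuous_on_vec_lambda)
  then show ?thesis by simp
qed

lemma sym_poly_mat_continuous_on:
  assumes "sym_poly_mat M" shows "continuous_on S M"
proof -
  have "continuous_on S (\<lambda>t. M t $ i $ j)" for i j
    using assms unfolding sym_poly_mat_def
    by (intro continuous_at_imp_continuous_on ballI continuous_real_polymonial_function) blast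
  then have "continuous_on S (\<lambda>t. \<chi> i j. M t $ i $ j)"
    by (intro continuous_on_vec_lambda)
  then show ?thesis by simp
qed

lemma continuous_on_kernel_section:
  assumes "sym_poly_mat K" shows "continuous_on S (\<lambda>s. K (t, s))"
  by (rule continuous_on_compose2[OF sym_poly_mat_continuous_on[OF assms, of UNIV]])
    (auto intro: continuous_on_Pair continuous_on_const continuous_on_id)

lemma psd_midpoint:
  assumes "psd P" "psd Q" shows "psd ((1/2) *\<^sub>R (P + Q))"
  using assms
  by (auto simp: psd_def sym_mat_def transpose_def vec_eq_iff matrix_vector_mult_add_rdistrib
      inner_add_right simp flip: scaleR_matrix_vector_assoc)

lemma psd_limit:
  assumes lim: "P \<longlonglongrightarrow> Q" and psd: "\<And>k. psd (P k)"
  shows "psd Q"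
proof -
  have entry: "(\<lambda>k. P k $ i $ j) \<longlonglongrightarrow> Q $ i $ j" for i j
    using lim by (intro tendsto_vec_nth)
  have "Q $ j $ i = Q $ i $ j" for i j
  proof -
    have "P k $ j $ i = P k $ i $ j" for k
      using psd[of k] by (simp add: psd_def sym_mat_def transpose_def vec_eq_iff)
    then show ?thesis
      using LIMSEQ_unique[OF entry[of j i]] entry[of i j] by simp
  qed
  moreover have "0 \<le> v \<bullet> (Q *v v)" for v
  proof (rule LIMSEQ_le_const)
    show "(\<lambda>k. v \<bullet> (P k *v v)) \<longlonglongrightarrow> v \<bullet> (Q *v v)"
      unfolding inner_vec_def matrix_vector_mult_def
      by (auto intro!: tendsto_intros entry)
    show "\<exists>N. \<forall>n\<ge>N. 0 \<le> v \<bullet> (P n *v v)"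
      using psd by (auto simp: psd_def)
  qed
  ultimately show ?thesis
    by (simp add: psd_def sym_mat_def transpose_def vec_eq_iff)
qed

section \<open>Bounded measurable functions\<close>

lemma finite_measure_lebesgue_on_Icc: "finite_measure (lebesgue_on {a..b::real})"
  using lmeasurable_cbox[of a b] by (intro finite_measure_lebesgue_on) simp

lemma AE_lebesgue_on_mono:
  assumes "AE t in lebesgue_on T. P t" "S \<subseteq> T" "S \<in> sets lebesgue" "T \<in> sets lebesgue"
  shows "AE t in lebesgue_on S. P t"
proof -
  have "AE t in lebesgue. t \<in> T \<longrightarrow> P t"
    using assms(1,4) by (simp add: AE_restrict_space_iff)
  then have "AE t in lebesgue. t \<in> S \<longrightarrow> P t"
    by (rule eventually_mono) (use assms(2) in blast)
  then show ?thesis using assms(3) by (simp add: AE_restrict_space_iff)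
qed

lemma Ln_measurable_on:
  assumes "x \<in> Ln" "t \<le> 1" shows "x \<in> borel_measurable (lebesgue_on {0..t})"
proof (rule measurable_restrict_mono)
  show "x \<in> borel_measurable (lebesgue_on {0..1})" using assms(1) by (simp add: Ln_def)
qed (use assms(2) in simp)

lemma Ln_bounded:
  fixes x :: "real \<Rightarrow> real ^ 'n"
  assumes "x \<in> Ln"
  obtains B where "0 \<le> B" "\<And>t. t \<in> {0..1} \<Longrightarrow> norm (x t) \<le> B"
proof -
  obtain b where b: "\<And>t i. t \<in> {0..1} \<Longrightarrow> \<bar>x t $ i\<bar> \<le> b"
    using assms unfolding Ln_def bdd_above_def by blast
  have "norm (x t) \<le> real CARD('n) * b" if "t \<in> {0..1}" for t
  proof -
    have "norm (x t) \<le> (\<Sum>i\<in>UNIV. \<bar>x t $ i\<bar>)" by (rule norm_le_l1_cart)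
    also have "\<dots> \<le> real CARD('n) * b" using b[OF that] by (intro sum_bounded_above) auto
    finally show ?thesis .
  qed
  moreover have "0 \<le> real CARD('n) * b"
    using b[of 0 undefined] by (intro mult_nonneg_nonneg) auto
  ultimately show thesis by (rule that[rotated])
qed

lemma LnI:
  assumes "x \<in> borel_measurable (lebesgue_on {0..1})" "\<And>t. t \<in> {0..1} \<Longrightarrow> norm (x t) \<le> B"
  shows "x \<in> Ln"
  using assms unfolding Ln_def
  by (auto intro!: bdd_aboveI[of _ B] intro: order_trans[OF component_le_norm_cart])

lemma Ln_midpoint:
  assumes "x \<in> Ln" "y \<in> Ln" shows "(\<lambda>t. (1/2) *\<^sub>R (x t + y t)) \<in> Ln"
proof -
  obtain B C where B: "\<And>t. t \<in> {0..1} \<Longrightarrow> norm (x t) \<le> B"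
    and C: "\<And>t. t \<in> {0..1} \<Longrightarrow> norm (y t) \<le> C"
    using assms Ln_bounded by metis
  have [measurable]: "x \<in> borel_measurable (lebesgue_on {0..1})"
    "y \<in> borel_measurable (lebesgue_on {0..1})"
    using assms by (auto simp: Ln_def)
  show ?thesis
  proof (rule LnI)
    show "norm ((1/2) *\<^sub>R (x t + y t)) \<le> (B + C) / 2" if "t \<in> {0..1}" for t
      using B[OF that] C[OF that] norm_triangle_ineq[of "x t" "y t"]
      by simp
  qed measurable
qed

lemma integrable_Ln_inner:
  assumes "x \<in> Ln" "y \<in> Ln" shows "integrable (lebesgue_on {0..1}) (\<lambda>t. x t \<bullet> y t)"
proof -
  interpret finite_measure "lebesgue_on {0..1::real}" by (rule finite_measure_lebesgue_on_Icc)
  obtain B C where B: "\<And>t. t \<in> {0..1} \<Longrightarrow> norm (x t) \<le> B" "0 \<le> B"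
    and C: "\<And>t. t \<in> {0..1} \<Longrightarrow> norm (y t) \<le> C"
    using assms Ln_bounded by metis
  have [measurable]: "x \<in> borel_measurable (lebesgue_on {0..1})"
    "y \<in> borel_measurable (lebesgue_on {0..1})"
    using assms by (auto simp: Ln_def)
  show ?thesis
  proof (rule integrable_const_bound)
    have "norm (x t \<bullet> y t) \<le> B * C" if "t \<in> {0..1}" for t
      using mult_mono[OF B(1)[OF that] C[OF that] B(2) norm_ge_zero] Cauchy_Schwarz_ineq2[of "x t" "y t"]
      by simp
    then show "AE t in lebesgue_on {0..1}. norm (x t \<bullet> y t) \<le> B * C"
      by (intro AE_I2) simp
  qed measurable
qed

lemma continuous_on_Icc_bounded:
  fixes g :: "real \<Rightarrow> 'b::real_normed_vector"
  assumes "continuous_on {a..b} g"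
  obtains B where "\<And>s. s \<in> {a..b} \<Longrightarrow> norm (g s) \<le> B"
proof -
  have "bounded (g ` {a..b})"
    using assms by (intro compact_imp_bounded compact_continuous_image) auto
  then show thesis using that unfolding bounded_iff by blast
qed

lemma continuous_on_imp_Ln:
  assumes "continuous_on {0..1} c" shows "c \<in> Ln"
proof -
  obtain B where "\<And>t. t \<in> {0..1} \<Longrightarrow> norm (c t) \<le> B"
    using continuous_on_Icc_bounded[OF assms] by blast
  then show ?thesis
    using assms by (intro LnI continuous_imp_measurable_on_sets_lebesgue) auto
qed

text \<open>
  The integral of a function that is not integrable is \<open>0\<close> by convention, so the linearity of
  the Volterra term of \<open>F\<close> in \<open>x\<close> rests on this integrability.
\<close>

lemma integrable_Ln_kernel:
  fixes g :: "real \<Rightarrow> 'b::euclidean_space"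
  assumes x: "x \<in> Ln" and t: "t \<le> 1" and g: "continuous_on {0..t} g"
  shows "integrable (lebesgue_on {0..t}) (\<lambda>s. x s $ i *\<^sub>R g s)"
proof -
  interpret finite_measure "lebesgue_on {0..t}" by (rule finite_measure_lebesgue_on_Icc)
  obtain B where B: "\<And>s. s \<in> {0..1} \<Longrightarrow> norm (x s) \<le> B" "0 \<le> B"
    using x Ln_bounded by metis
  obtain C where C: "\<And>s. s \<in> {0..t} \<Longrightarrow> norm (g s) \<le> C"
    using continuous_on_Icc_bounded[OF g] by blast
  have meas: "x \<in> borel_measurable (lebesgue_on {0..t})"
    "g \<in> borel_measurable (lebesgue_on {0..t})"
    using Ln_measurable_on[OF x t] continuous_imp_measurable_on_sets_lebesgue[OF g] by auto
  show ?thesis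
  proof (rule integrable_const_bound)
    show "AE s in lebesgue_on {0..t}. norm (x s $ i *\<^sub>R g s) \<le> B * C"
      using B C t
      by (intro AE_I2) (auto intro!: mult_mono intro: order_trans[OF component_le_norm_cart])
    show "(\<lambda>s. x s $ i *\<^sub>R g s) \<in> borel_measurable (lebesgue_on {0..t})"
      using meas unfolding cart_eq_inner_axis by measurable
  qed
qed

section \<open>The feasible set is convex and closed under bounded almost everywhere limits\<close>

lemma tvsdp_F_midpoint:
  fixes A0 :: "real \<Rightarrow> real ^ 'm ^ 'm"
  assumes D: "\<And>i. sym_poly_mat (D i)" and x: "x \<in> Ln" and y: "y \<in> Ln" and t: "t \<in> {0..1}"
  shows "tvsdp_F A0 A D (\<lambda>t. (1/2) *\<^sub>R (x t + y t)) t
       = (1/2) *\<^sub>R (tvsdp_F A0 A D x t + tvsdp_F A0 A D y t)"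
proof -
  have int: "integrable (lebesgue_on {0..t}) (\<lambda>s. z s $ i *\<^sub>R D i (t, s))" if "z \<in> Ln" for z i
    using t by (intro integrable_Ln_kernel[OF that] continuous_on_kernel_section[OF D]) simp
  have "(LINT s|lebesgue_on {0..t}. ((1/2) *\<^sub>R (x s + y s)) $ i *\<^sub>R D i (t, s))
      = (1/2) *\<^sub>R ((LINT s|lebesgue_on {0..t}. x s $ i *\<^sub>R D i (t, s))
                 + (LINT s|lebesgue_on {0..t}. y s $ i *\<^sub>R D i (t, s)))" for i
  proof -
    have "(LINT s|lebesgue_on {0..t}. ((1/2) *\<^sub>R (x s + y s)) $ i *\<^sub>R D i (t, s))
        = (LINT s|lebesgue_on {0..t}. (1/2) *\<^sub>R (x s $ i *\<^sub>R D i (t, s) + y s $ i *\<^sub>R D i (t, s)))"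
      by (intro Bochner_Integration.integral_cong refl) (simp add: algebra_simps)
    also have "\<dots> = (1/2) *\<^sub>R (LINT s|lebesgue_on {0..t}. x s $ i *\<^sub>R D i (t, s) + y s $ i *\<^sub>R D i (t, s))"
      by (rule integral_scaleR_right)
    finally show ?thesis
      by (simp only: Bochner_Integration.integral_add[OF int[OF x] int[OF y]])
  qed
  then have volterra: "(\<Sum>i\<in>UNIV. LINT s|lebesgue_on {0..t}. ((1/2) *\<^sub>R (x s + y s)) $ i *\<^sub>R D i (t, s))
      = (1/2) *\<^sub>R ((\<Sum>i\<in>UNIV. LINT s|lebesgue_on {0..t}. x s $ i *\<^sub>R D i (t, s))
                 + (\<Sum>i\<in>UNIV. LINT s|lebesgue_on {0..t}. y s $ i *\<^sub>R D i (t, s)))"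
    by (simp only: scaleR_sum_right sum.distrib[symmetric])
  have pointwise: "(\<Sum>i\<in>UNIV. ((1/2) *\<^sub>R (x t + y t)) $ i *\<^sub>R A i t)
      = (1/2) *\<^sub>R ((\<Sum>i\<in>UNIV. x t $ i *\<^sub>R A i t) + (\<Sum>i\<in>UNIV. y t $ i *\<^sub>R A i t))"
    unfolding sum.distrib[symmetric] scaleR_sum_right
    by (intro sum.cong refl) (simp add: algebra_simps add_divide_distrib)
  have regroup: "a + (1/2) *\<^sub>R (p + q) + (1/2) *\<^sub>R (u + v)
      = (1/2) *\<^sub>R ((a + p + u) + (a + q + v))" for a p q u v :: "real ^ 'm ^ 'm"
    by (simp add: vec_eq_iff field_simps)
  show ?thesis
    unfolding tvsdp_F_def volterra pointwise by (rule regroup)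
qed

lemma tvsdp_feasible_midpoint:
  assumes D: "\<And>i. sym_poly_mat (D i)"
    and x: "x \<in> tvsdp_feasible A0 A D" and y: "y \<in> tvsdp_feasible A0 A D"
  shows "(\<lambda>t. (1/2) *\<^sub>R (x t + y t)) \<in> tvsdp_feasible A0 A D"
proof -
  have Ln: "x \<in> Ln" "y \<in> Ln" using x y by (auto simp: tvsdp_feasible_def)
  have "AE t in lebesgue_on {0..1}. psd (tvsdp_F A0 A D x t)"
    "AE t in lebesgue_on {0..1}. psd (tvsdp_F A0 A D y t)"
    using x y by (auto simp: tvsdp_feasible_def)
  then have "AE t in lebesgue_on {0..1}. psd (tvsdp_F A0 A D (\<lambda>t. (1/2) *\<^sub>R (x t + y t)) t)"
    using AE_space
    by eventually_elim (simp add: tvsdp_F_midpoint[OF D Ln] psd_midpoint)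
  then show ?thesis
    using Ln_midpoint[OF Ln] by (simp add: tvsdp_feasible_def)
qed

lemma tvsdp_objective_midpoint:
  assumes "poly_vec c" "x \<in> Ln" "y \<in> Ln"
  shows "tvsdp_objective c (\<lambda>t. (1/2) *\<^sub>R (x t + y t))
       = (tvsdp_objective c x + tvsdp_objective c y) / 2"
proof -
  have c: "c \<in> Ln" by (rule continuous_on_imp_Ln[OF poly_vec_continuous_on[OF assms(1)]])
  have "tvsdp_objective c (\<lambda>t. (1/2) *\<^sub>R (x t + y t))
      = (LINT t|lebesgue_on {0..1}. (c t \<bullet> x t + c t \<bullet> y t) / 2)"
    unfolding tvsdp_objective_def
    by (intro Bochner_Integration.integral_cong refl) (simp add: inner_add_right)
  also have "\<dots> = (LINT t|lebesgue_on {0..1}. c t \<bullet> x t + c t \<bullet> y t) / 2"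
    by (rule integral_divide_zero)
  also have "\<dots> = (tvsdp_objective c x + tvsdp_objective c y) / 2"
    unfolding tvsdp_objective_def
    by (simp only: Bochner_Integration.integral_add[OF integrable_Ln_inner[OF c assms(2)]
          integrable_Ln_inner[OF c assms(3)]])
  finally show ?thesis .
qed

text \<open>
  Dominated convergence handles the Volterra term at every \<open>t\<close>, because it sees \<open>y k\<close> only up to
  null sets.  The terms \<open>x t $ i *\<^sub>R A i t\<close> depend on the value at \<open>t\<close> itself, whence the separate
  assumption of convergence there.
\<close>

lemma tvsdp_F_tendsto:
  assumes D: "\<And>i. sym_poly_mat (D i)" and t: "t \<in> {0..1}"
    and Ln: "\<And>k. y k \<in> Ln" "z \<in> Ln"
    and bound: "\<And>k. AE s in lebesgue_on {0..1}. norm (y k s) \<le> \<Gamma>"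
    and conv: "AE s in lebesgue_on {0..1}. (\<lambda>k. y k s) \<longlonglongrightarrow> z s"
    and conv_t: "(\<lambda>k. y k t) \<longlonglongrightarrow> z t"
  shows "(\<lambda>k. tvsdp_F A0 A D (y k) t) \<longlonglongrightarrow> tvsdp_F A0 A D z t"
proof -
  have "(\<lambda>k. LINT s|lebesgue_on {0..t}. y k s $ i *\<^sub>R D i (t, s))
      \<longlonglongrightarrow> (LINT s|lebesgue_on {0..t}. z s $ i *\<^sub>R D i (t, s))" for i
  proof -
    have D_cont: "continuous_on {0..t} (\<lambda>s. D i (t, s))"
      using D by (rule continuous_on_kernel_section)
    obtain C where C: "\<And>s. s \<in> {0..t} \<Longrightarrow> norm (D i (t, s)) \<le> C"
      using continuous_on_Icc_bounded[OF D_cont] by blast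
    have int: "integrable (lebesgue_on {0..t}) (\<lambda>s. w s $ i *\<^sub>R D i (t, s))" if "w \<in> Ln" for w
      using t by (intro integrable_Ln_kernel[OF that _ D_cont]) simp
    show ?thesis
    proof (rule integral_dominated_convergence[where w = "\<lambda>_. \<Gamma> * C"])
      show "integrable (lebesgue_on {0..t}) (\<lambda>_. \<Gamma> * C)"
        by (rule finite_measure.integrable_const[OF finite_measure_lebesgue_on_Icc])
      show "AE s in lebesgue_on {0..t}. (\<lambda>k. y k s $ i *\<^sub>R D i (t, s)) \<longlonglongrightarrow> z s $ i *\<^sub>R D i (t, s)"
        using AE_lebesgue_on_mono[OF conv, of "{0..t}"] t
        by (auto elim!: eventually_mono intro!: tendsto_intros)
      show "AE s in lebesgue_on {0..t}. norm (y k s $ i *\<^sub>R D i (t, s)) \<le> \<Gamma> * C" for k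
      proof -
        have "AE s in lebesgue_on {0..t}. norm (y k s) \<le> \<Gamma>"
          using AE_lebesgue_on_mono[OF bound, of "{0..t}"] t by auto
        then show ?thesis
          using AE_space
        proof eventually_elim
          case (elim s)
          have "0 \<le> \<Gamma>" using elim(1) norm_ge_zero order_trans by blast
          then show ?case
            using elim C[of s] component_le_norm_cart[of "y k s" i] by (auto intro!: mult_mono)
        qed
      qed
    qed (use int Ln in \<open>auto intro: borel_measurable_integrable\<close>)
  qed
  then show ?thesis
    unfolding tvsdp_F_def by (intro tendsto_intros conv_t)
qed

text \<open>
  Each \<open>y k\<close> may violate the matrix inequality on its own null set.  Outside the union of these
  countably many null sets and the set of divergence, \<open>F\<close> converges within the closed cone.
\<close>

lemma tvsdp_feasible_limit:
  assumes D: "\<And>i. sym_poly_mat (D i)"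
    and y: "\<And>k. y k \<in> tvsdp_feasible A0 A D" and z: "z \<in> Ln"
    and bound: "\<And>k. AE s in lebesgue_on {0..1}. norm (y k s) \<le> \<Gamma>"
    and conv: "AE s in lebesgue_on {0..1}. (\<lambda>k. y k s) \<longlonglongrightarrow> z s"
  shows "z \<in> tvsdp_feasible A0 A D"
proof -
  have Ln: "\<And>k. y k \<in> Ln" using y by (auto simp: tvsdp_feasible_def)
  have "AE t in lebesgue_on {0..1}. \<forall>k. psd (tvsdp_F A0 A D (y k) t)"
    using y by (auto simp: tvsdp_feasible_def AE_all_countable)
  then have "AE t in lebesgue_on {0..1}. psd (tvsdp_F A0 A D z t)"
    using conv AE_space
  proof eventually_elim
    case (elim t)
    then have "(\<lambda>k. tvsdp_F A0 A D (y k) t) \<longlonglongrightarrow> tvsdp_F A0 A D z t"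
      by (intro tvsdp_F_tendsto[OF D _ Ln z bound conv]) auto
    then show ?case using elim(1) by (auto intro: psd_limit)
  qed
  with z show ?thesis by (simp add: tvsdp_feasible_def)
qed

lemma tvsdp_objective_tendsto:
  assumes c: "poly_vec c" and Ln: "\<And>k. y k \<in> Ln" "z \<in> Ln"
    and bound: "\<And>k. AE s in lebesgue_on {0..1}. norm (y k s) \<le> \<Gamma>"
    and conv: "AE s in lebesgue_on {0..1}. (\<lambda>k. y k s) \<longlonglongrightarrow> z s"
  shows "(\<lambda>k. tvsdp_objective c (y k)) \<longlonglongrightarrow> tvsdp_objective c z"
proof -
  have c_Ln: "c \<in> Ln" by (rule continuous_on_imp_Ln[OF poly_vec_continuous_on[OF c]])
  obtain C where C: "0 \<le> C" "\<And>t. t \<in> {0..1} \<Longrightarrow> norm (c t) \<le> C"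
    using Ln_bounded[OF c_Ln] by blast
  show ?thesis
    unfolding tvsdp_objective_def
  proof (rule integral_dominated_convergence[where w = "\<lambda>_. C * \<Gamma>"])
    show "integrable (lebesgue_on {0..1::real}) (\<lambda>_. C * \<Gamma>)"
      by (rule finite_measure.integrable_const[OF finite_measure_lebesgue_on_Icc])
    show "AE s in lebesgue_on {0..1}. (\<lambda>k. c s \<bullet> y k s) \<longlonglongrightarrow> c s \<bullet> z s"
      using conv by eventually_elim (intro tendsto_intros)
    show "AE s in lebesgue_on {0..1}. norm (c s \<bullet> y k s) \<le> C * \<Gamma>" for k
      using bound[of k] AE_space
      by eventually_elim
        (use C in \<open>auto intro!: order_trans[OF Cauchy_Schwarz_ineq2] mult_mono\<close>)
  qed (use integrable_Ln_inner[OF c_Ln] Ln in \<open>auto intro: borel_measurable_integrable\<close>)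
qed

section \<open>Existence of an optimal solution\<close>

theorem theorem3:
  fixes c :: "real \<Rightarrow> real ^ 'n"
    and A0 :: "real \<Rightarrow> real ^ 'm ^ 'm"
    and A :: "'n \<Rightarrow> real \<Rightarrow> real ^ 'm ^ 'm"
    and D :: "'n \<Rightarrow> real \<times> real \<Rightarrow> real ^ 'm ^ 'm"
  assumes "poly_vec c"
    and "sym_poly_mat A0"
    and "\<And>i. sym_poly_mat (A i)"
    and "\<And>i. sym_poly_mat (D i)"
    and "tvsdp_feasible A0 A D \<noteq> {}"
    and "\<exists>\<gamma>>0. \<forall>x\<in>tvsdp_feasible A0 A D. AE t in lebesgue_on {0..1}. infnorm (x t) \<le> \<gamma>"
  shows "\<exists>x\<^sub>o\<^sub>p\<^sub>t\<in>tvsdp_feasible A0 A D.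
           ereal (tvsdp_objective c x\<^sub>o\<^sub>p\<^sub>t) = tvsdp_value c A0 A D"
proof -
  let ?I = "lebesgue_on {0..1::real}"
  let ?X = "tvsdp_feasible A0 A D"
  interpret finite_measure ?I by (rule finite_measure_lebesgue_on_Icc)
  have X_Ln: "x \<in> Ln" if "x \<in> ?X" for x using that by (simp add: tvsdp_feasible_def)
  obtain \<gamma> where \<gamma>: "\<And>x. x \<in> ?X \<Longrightarrow> AE t in ?I. infnorm (x t) \<le> \<gamma>"
    using assms(6) by blast
  define \<Gamma> where "\<Gamma> = sqrt DIM(real ^ 'n) * \<gamma>"
  have bound: "AE t in ?I. norm (x t) \<le> \<Gamma>" if "x \<in> ?X" for x
    using \<gamma>[OF that]
  proof eventually_elim
    case (elim t)
    show ?case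
      unfolding \<Gamma>_def
      by (rule order_trans[OF norm_le_infnorm mult_left_mono[OF elim]]) simp
  qed
  obtain a :: "nat \<Rightarrow> ereal" where a: "incseq a"
    "range a \<subseteq> (\<lambda>x. ereal (tvsdp_objective c x)) ` ?X" "tvsdp_value c A0 A D = (SUP k. a k)"
    using Sup_countable_SUP[of "(\<lambda>x. ereal (tvsdp_objective c x)) ` ?X"] assms(5)
    unfolding tvsdp_value_def by auto
  define S where "S k = {x \<in> ?X. a k \<le> ereal (tvsdp_objective c x)}" for k
  have S_X: "S k \<subseteq> ?X" for k by (auto simp: S_def)
  have "\<exists>y. \<forall>k. y k \<in> S k \<and> (LINT t|?I. (norm (y (Suc k) t - y k t))\<^sup>2) \<le> (1/4)^k"
  proof (rule exists_L2_Cauchy_selection)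
    show "S k \<noteq> {}" for k
    proof -
      have "a k \<in> (\<lambda>x. ereal (tvsdp_objective c x)) ` ?X" using a(2) by blast
      then show ?thesis by (auto simp: S_def)
    qed
    show "decseq S"
      using a(1) by (auto simp: decseq_def incseq_def S_def intro: order_trans)
    show "(\<lambda>t. (1/2) *\<^sub>R (x t + y t)) \<in> S k" if xy: "x \<in> S k" "y \<in> S k" for k x y
    proof -
      have "min (tvsdp_objective c x) (tvsdp_objective c y)
          \<le> tvsdp_objective c (\<lambda>t. (1/2) *\<^sub>R (x t + y t))"
        using xy X_Ln assms(1) by (subst tvsdp_objective_midpoint) (auto simp: S_def)
      moreover have "a k \<le> ereal (min (tvsdp_objective c x) (tvsdp_objective c y))"
        using xy by (auto simp: S_def min_def)
      ultimately have "a k \<le> ereal (tvsdp_objective c (\<lambda>t. (1/2) *\<^sub>R (x t + y t)))"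
        by (meson ereal_less_eq(3) order_trans)
      then show ?thesis
        using tvsdp_feasible_midpoint[OF assms(4)] xy by (auto simp: S_def)
    qed
    show "integrable ?I (\<lambda>t. x t \<bullet> y t)" if "x \<in> S 0" "y \<in> S 0" for x y
      using that S_X X_Ln by (intro integrable_Ln_inner) auto
    show "(LINT t|?I. x t \<bullet> x t) \<le> (LINT t|?I. \<Gamma>\<^sup>2)" if "x \<in> S 0" for x
    proof (rule integral_mono_AE)
      show "integrable ?I (\<lambda>t. x t \<bullet> x t)"
        using that S_X X_Ln by (intro integrable_Ln_inner) auto
      have "AE t in ?I. norm (x t) \<le> \<Gamma>" using that S_X bound by blast
      then show "AE t in ?I. x t \<bullet> x t \<le> \<Gamma>\<^sup>2"
        by eventually_elim (auto simp flip: power2_norm_eq_inner intro: power_mono)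
    qed simp
  qed
  then obtain y where y_S: "\<And>k. y k \<in> S k"
    and increments: "\<And>k. (LINT t|?I. (norm (y (Suc k) t - y k t))\<^sup>2) \<le> (1/4)^k"
    by blast
  have y_X: "y k \<in> ?X" for k using y_S S_X by blast
  have y_Ln: "y k \<in> Ln" for k using y_X X_Ln by blast
  have [measurable]: "y k \<in> borel_measurable ?I" for k using y_Ln by (auto simp: Ln_def)
  have "integrable ?I (\<lambda>t. (norm (y (Suc k) t - y k t))\<^sup>2)" for k
    using y_Ln by (simp add: power2_norm_eq_inner inner_diff_left inner_diff_right integrable_Ln_inner)
  then have conv: "AE t in ?I. convergent (\<lambda>k. y k t)"
    using increments by (intro AE_convergent_of_L2_increments) auto
  \<comment> \<open>Membership in \<open>Ln\<close> asks for a bound at every point, so the limit is cut off where it exceeds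
    the bound \<open>\<Gamma>\<close>, which happens only on a null set.\<close>
  define z where "z t = (let l = lim (\<lambda>k. y k t) in if norm l \<le> \<Gamma> then l else 0)" for t
  have [measurable]: "(\<lambda>t. lim (\<lambda>k. y k t)) \<in> borel_measurable ?I"
    by (rule borel_measurable_lim_metric) measurable
  have z_Ln: "z \<in> Ln"
  proof (rule LnI)
    show "z \<in> borel_measurable ?I" unfolding z_def Let_def by measurable
    show "norm (z t) \<le> \<bar>\<Gamma>\<bar>" for t by (auto simp: z_def Let_def)
  qed
  have y_bound: "AE t in ?I. norm (y k t) \<le> \<Gamma>" for k using y_X bound by blast
  have "AE t in ?I. \<forall>k. norm (y k t) \<le> \<Gamma>"
    using y_bound by (simp add: AE_all_countable)
  with conv have y_z: "AE t in ?I. (\<lambda>k. y k t) \<longlonglongrightarrow> z t"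
  proof eventually_elim
    case (elim t)
    have l: "(\<lambda>k. y k t) \<longlonglongrightarrow> lim (\<lambda>k. y k t)"
      using elim(1) by (simp add: convergent_LIMSEQ_iff)
    have "norm (lim (\<lambda>k. y k t)) \<le> \<Gamma>"
      by (rule LIMSEQ_le_const2[OF tendsto_norm[OF l]]) (use elim(2) in auto)
    with l show ?case by (simp add: z_def)
  qed
  have z_X: "z \<in> ?X"
    by (rule tvsdp_feasible_limit[OF assms(4) y_X z_Ln y_bound y_z])
  have "(\<lambda>k. ereal (tvsdp_objective c (y k))) \<longlonglongrightarrow> ereal (tvsdp_objective c z)"
    using tvsdp_objective_tendsto[OF assms(1) y_Ln z_Ln y_bound y_z] by simp
  then have "a k \<le> ereal (tvsdp_objective c z)" for k
  proof (rule LIMSEQ_le_const)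
    show "\<exists>N. \<forall>n\<ge>N. a k \<le> ereal (tvsdp_objective c (y n))"
      using y_S a(1) by (auto simp: S_def incseq_def intro!: exI[of _ k] intro: order_trans)
  qed
  then have "tvsdp_value c A0 A D \<le> ereal (tvsdp_objective c z)"
    unfolding a(3) by (rule SUP_least)
  moreover have "ereal (tvsdp_objective c z) \<le> tvsdp_value c A0 A D"
    unfolding tvsdp_value_def using z_X by (rule SUP_upper)
  ultimately show ?thesis
    using z_X by (auto intro: antisym)
qed

end
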